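(* For every real $s$ with $0\leq s\leq 1$ and every integer $n\geq 1$ there is a constant $C=C(s,n)$ with the following property. If $Q_1=(0,1)^n\subset\mathbb{R}^n$ and $f\in C^s(Q_1)$ is real-valued, then $$\int_{\mathbb{R}} \mathcal{H}^{n-s}\bigl(\{x\in Q_1 : f(x)=y\}\bigr)\,dy\leq C\,[f]_s .$$
   Context: $\mathcal{H}^{a}$ denotes the $a$-dimensional Hausdorff measure in $\mathbb{R}^n$ (with respect to the Euclidean distance). $[f]_s:=\sup_{x\neq y}\frac{|f(x)-f(y)|}{|x-y|^s}$ is the Hölder seminorm of $f$ on $Q_1$, and $C^s(Q_1)$ is the space of continuous functions $f:Q_1\to\mathbb{R}$ with $[f]_s<\infty$. *)

theory Defs
  imports "HOL-Analysis.Analysis"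
begin

text \<open>
  The exponent \<open>a = 0\<close> is treated separately because \<open>0 powr 0 = 0\<close>: a nonempty set must have
  \<open>0\<close>-dimensional weight \<open>1\<close> even if it is a single point, so that the \<open>0\<close>-dimensional
  measure is the counting measure. The factor \<open>unit_ball_vol a / 2 powr a\<close> is the usual
  normalisation, under which the \<open>n\<close>-dimensional measure on \<open>n\<close>-space is Lebesgue measure.
\<close>

definition hausdorff_weight :: "real \<Rightarrow> 'a::metric_space set \<Rightarrow> ennreal" where
  "hausdorff_weight a E =
     (if E = {} then 0
      else if a = 0 then 1
      else ennreal (unit_ball_vol a * (diameter E / 2) powr a))"

text \<open>Boundedness is required since \<^const>\<open>diameter\<close> is meaningless on unbounded sets.\<close>

definition hausdorff_premeasure :: "real \<Rightarrow> real \<Rightarrow> 'a::metric_space set \<Rightarrow> ennreal" where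
  "hausdorff_premeasure a \<delta> A =
     (INF E\<in>{E :: nat \<Rightarrow> 'a set. A \<subseteq> (\<Union>i. E i) \<and> (\<forall>i. bounded (E i) \<and> diameter (E i) \<le> \<delta>)}.
        \<Sum>i. hausdorff_weight a (E i))"

definition hausdorff_measure :: "real \<Rightarrow> 'a::metric_space set \<Rightarrow> ennreal" where
  "hausdorff_measure a A = (SUP \<delta>\<in>{0<..}. hausdorff_premeasure a \<delta> A)"

definition holder_seminorm :: "real \<Rightarrow> 'a::metric_space set \<Rightarrow> ('a \<Rightarrow> real) \<Rightarrow> ennreal" where
  "holder_seminorm s Q f =
     (SUP (x, y)\<in>{(x, y). x \<in> Q \<and> y \<in> Q \<and> x \<noteq> y}. ennreal (\<bar>f x - f y\<bar> / dist x y powr s))"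

definition holder_space :: "real \<Rightarrow> 'a::metric_space set \<Rightarrow> ('a \<Rightarrow> real) set" where
  "holder_space s Q = {f. continuous_on Q f \<and> holder_seminorm s Q f < \<infinity>}"

definition unit_cube :: "(real ^ 'n) set" where
  "unit_cube = {x. \<forall>i. 0 < x $ i \<and> x $ i < 1}"

end

theory Submission
  imports Defs
begin

text \<open>
  Cover the cube by \<open>N\<^sup>n\<close> cubes of diameter \<open>d = sqrt n / N\<close>. The level set over \<open>y\<close> is covered by
  those small cubes whose image contains \<open>y\<close>, and each image lies in an interval of length
  \<open>2 [f] d powr s\<close>. Integrating over \<open>y\<close>, the premeasures contribute at most a constant times
  \<open>N\<^sup>n * d powr (n - s) * [f] d powr s\<close>, which does not depend on \<open>N\<close>; Fatou's lemma concludes.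
\<close>

text \<open>Monotonicity of powers gives the bound for positive exponents. For \<open>a = 0\<close>
  the weight of a nonempty set is 1, and \<open>0 < d\<close> makes the right-hand side 1 as
  well.\<close>

lemma hausdorff_weight_le:
  assumes "bounded E" "diameter E \<le> d" "0 < d" "0 \<le> a"
  shows "hausdorff_weight a E \<le> ennreal (unit_ball_vol a * (d / 2) powr a)"
proof (cases "a = 0")
  case True
  then show ?thesis using assms by (auto simp: hausdorff_weight_def)
next
  case False
  have "0 \<le> diameter E" using assms(1) by (rule diameter_ge_0)
  then have "(diameter E / 2) powr a \<le> (d / 2) powr a"
    using assms by (intro powr_mono2) auto
  then show ?thesis
    using False assms by (auto simp: hausdorff_weight_def intro!: ennreal_leI mult_left_mono)
qed

lemma hausdorff_premeasure_le_sum: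
  assumes "finite I" "A \<subseteq> (\<Union>i\<in>I. E i)" "0 \<le> \<delta>"
    and E: "\<And>i. i \<in> I \<Longrightarrow> bounded (E i) \<and> diameter (E i) \<le> \<delta>"
  shows "hausdorff_premeasure a \<delta> A \<le> (\<Sum>i\<in>I. hausdorff_weight a (E i))"
proof -
  obtain h where h: "bij_betw h {..<card I} I"
    using ex_bij_betw_nat_finite[OF assms(1)] by (auto simp: atLeast0LessThan)
  \<comment> \<open>The premeasure admits only sequences of sets, so the finite family is padded
    with empty sets, which have weight 0 for every exponent.\<close>
  define F where "F i = (if i < card I then E (h i) else {})" for i
  have hI: "h i \<in> I" if "i < card I" for i
    using h that by (auto simp: bij_betw_def)
  have "A \<subseteq> (\<Union>i. F i)"
  proof
    fix x assume "x \<in> A"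
    then obtain i where "i \<in> I" "x \<in> E i" using assms(2) by auto
    moreover obtain j where "j < card I" "i = h j"
      using h \<open>i \<in> I\<close> by (auto simp: bij_betw_def)
    ultimately have "x \<in> F j" by (simp add: F_def)
    then show "x \<in> (\<Union>i. F i)" by blast
  qed
  moreover have "bounded (F i) \<and> diameter (F i) \<le> \<delta>" for i
    using E[OF hI] assms(3) by (simp add: F_def)
  ultimately have "hausdorff_premeasure a \<delta> A \<le> (\<Sum>i. hausdorff_weight a (F i))"
    unfolding hausdorff_premeasure_def by (intro INF_lower) blast
  also have "\<dots> = (\<Sum>i<card I. hausdorff_weight a (F i))"
    by (intro suminf_finite) (auto simp: F_def hausdorff_weight_def)
  also have "\<dots> = (\<Sum>i<card I. hausdorff_weight a (E (h i)))"
    by (simp add: F_def)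
  also have "\<dots> = (\<Sum>i\<in>I. hausdorff_weight a (E i))"
    by (rule sum.reindex_bij_betw[OF h])
  finally show ?thesis .
qed

lemma hausdorff_premeasure_antimono:
  assumes "\<delta> \<le> \<epsilon>"
  shows "hausdorff_premeasure a \<epsilon> A \<le> hausdorff_premeasure a \<delta> A"
  unfolding hausdorff_premeasure_def
  by (rule INF_superset_mono) (use assms in \<open>auto intro: order_trans\<close>)

text \<open>Eventually \<open>d k\<close> drops below any fixed \<delta>, and finer covers only
  increase the premeasure. This trades the supremum over all \<delta> for a sequence, the form that
  Fatou's lemma can handle.\<close>

lemma hausdorff_measure_le_liminf:
  assumes "d \<longlonglongrightarrow> 0"
  shows "hausdorff_measure a A \<le> liminf (\<lambda>k. hausdorff_premeasure a (d k) A)"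
  unfolding hausdorff_measure_def
proof (rule SUP_least)
  fix \<delta> :: real assume "\<delta> \<in> {0<..}"
  then have "\<forall>\<^sub>F k in sequentially. d k < \<delta>"
    using order_tendstoD(2)[OF assms] by simp
  then show "hausdorff_premeasure a \<delta> A \<le> liminf (\<lambda>k. hausdorff_premeasure a (d k) A)"
    by (intro Liminf_bounded) (auto elim!: eventually_mono intro!: hausdorff_premeasure_antimono)
qed

lemma holder_seminorm_bound:
  assumes "holder_seminorm s Q f = ennreal L" "0 \<le> L" "x \<in> Q" "y \<in> Q"
  shows "\<bar>f x - f y\<bar> \<le> L * dist x y powr s"
\<comment> \<open>The supremum omits the diagonal; there both sides are 0, even for
  \<open>s = 0\<close>, since \<open>0 powr 0 = 0\<close>.\<close>
proof (cases "x = y")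
  case False
  have "ennreal (\<bar>f x - f y\<bar> / dist x y powr s) \<le> ennreal L"
    unfolding assms(1)[symmetric] holder_seminorm_def
    by (rule SUP_upper2[of "(x, y)"]) (use assms False in auto)
  then show ?thesis
    using False assms(2) by (simp add: divide_simps)
qed simp

text \<open>Eilenberg's inequality, with a bound on covering numbers in place of the \<open>b\<close>-dimensional
  Hausdorff measure of \<open>Q\<close>.\<close>

lemma nn_integral_hausdorff_measure_level_sets_le:
  fixes f :: "'a::metric_space \<Rightarrow> real" and P :: "nat \<Rightarrow> 'i \<Rightarrow> 'a set"
  assumes "0 \<le> s" "s \<le> b" "0 \<le> L" "0 \<le> K"
    and L: "holder_seminorm s Q f = ennreal L"
    and d: "\<And>k. 0 < d k" "d \<longlonglongrightarrow> 0"
    and I: "\<And>k. finite (I k)" "\<And>k. real (card (I k)) * d k powr b \<le> K"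
    and cover: "\<And>k. Q \<subseteq> (\<Union>i\<in>I k. P k i)"
    and diam: "\<And>k i x y. i \<in> I k \<Longrightarrow> x \<in> P k i \<Longrightarrow> y \<in> P k i \<Longrightarrow> dist x y \<le> d k"
  shows "(\<integral>\<^sup>+ y. hausdorff_measure (b - s) {x \<in> Q. f x = y} \<partial>lborel)
    \<le> ennreal (2 * unit_ball_vol (b - s) / 2 powr (b - s) * K) * holder_seminorm s Q f"
proof -
  define w where "w k = unit_ball_vol (b - s) * (d k / 2) powr (b - s)" for k
  \<comment> \<open>A sample point of each piece. It is arbitrary if the piece misses
    \<open>Q\<close>, but then the piece meets no level set in \<open>Q\<close>.\<close>
  define p where "p k i = (SOME x. x \<in> Q \<inter> P k i)" for k i
  define r where "r k = L * d k powr s" for k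
  \<comment> \<open>A Borel majorant of the premeasure: piece \<open>i\<close> is charged
    \<open>w k\<close> exactly for \<open>y\<close> within \<open>r k\<close> of the sample value,
    an interval containing the image of the piece.\<close>
  define g where
    "g k y = (\<Sum>i\<in>I k. ennreal (w k) * indicator {f (p k i) - r k .. f (p k i) + r k} y)" for k y
  have w0: "0 \<le> w k" for k using assms by (simp add: w_def)
  have r0: "0 \<le> r k" for k using assms by (simp add: r_def)
  have premeasure_le: "hausdorff_premeasure (b - s) (d k) {x \<in> Q. f x = y} \<le> g k y" for k y
  proof -
    define E where "E i = {x \<in> Q \<inter> P k i. f x = y}" for i
    have dE: "dist u v \<le> d k" if "i \<in> I k" "u \<in> E i" "v \<in> E i" for i u v
      using diam that by (auto simp: E_def)
    have bd: "bounded (E i)" if "i \<in> I k" for i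
      using dE[OF that] unfolding bounded_two_points by blast
    have dm: "diameter (E i) \<le> d k" if "i \<in> I k" for i
    proof (cases "E i = {}")
      case False
      then show ?thesis
        unfolding diameter_def using dE[OF that] by (simp, intro cSUP_least) auto
    qed (use d(1)[of k] in simp)
    have "hausdorff_premeasure (b - s) (d k) {x \<in> Q. f x = y}
      \<le> (\<Sum>i\<in>I k. hausdorff_weight (b - s) (E i))"
      using I(1) cover[of k] d(1)[of k] bd dm
      by (intro hausdorff_premeasure_le_sum) (auto simp: E_def)
    also have "\<dots> \<le> g k y"
      unfolding g_def
    proof (rule sum_mono)
      fix i assume i: "i \<in> I k"
      show "hausdorff_weight (b - s) (E i)
        \<le> ennreal (w k) * indicator {f (p k i) - r k .. f (p k i) + r k} y"
      proof (cases "E i = {}")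
        case True
        then show ?thesis by (simp add: hausdorff_weight_def)
      next
        case False
        then obtain x where x: "x \<in> Q" "x \<in> P k i" "f x = y" by (auto simp: E_def)
        \<comment> \<open>The point \<open>x\<close> of the level set shows that the piece meets
          \<open>Q\<close>, so the choice of the sample point is meaningful.\<close>
        then have p: "p k i \<in> Q \<inter> P k i"
          unfolding p_def some_in_eq by blast
        have "\<bar>f x - f (p k i)\<bar> \<le> L * dist x (p k i) powr s"
          using x p by (intro holder_seminorm_bound[OF L \<open>0 \<le> L\<close>]) auto
        also have "\<dots> \<le> r k"
          unfolding r_def using diam[OF i x(2)] p assms(1,3)
          by (intro mult_left_mono powr_mono2) auto
        finally have "y \<in> {f (p k i) - r k .. f (p k i) + r k}"
          using x(3) by (auto simp: abs_le_iff)
        then show ?thesis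
          using hausdorff_weight_le[OF bd[OF i] dm[OF i] d(1)] assms(2) by (simp add: w_def)
      qed
    qed
    finally show ?thesis .
  qed
  have integral_g: "(\<integral>\<^sup>+ y. g k y \<partial>lborel)
    \<le> ennreal (2 * unit_ball_vol (b - s) / 2 powr (b - s) * K * L)" for k
  proof -
    have "(\<integral>\<^sup>+ y. g k y \<partial>lborel) = (\<Sum>i\<in>I k. ennreal (w k) * ennreal (2 * r k))"
      unfolding g_def using r0[of k]
      by (subst nn_integral_sum) (auto simp: nn_integral_cmult_indicator)
    also have "\<dots> = ennreal (real (card (I k)) * (w k * (2 * r k)))"
      using w0[of k] r0[of k] by (simp add: ennreal_mult ennreal_of_nat_eq_real_of_nat)
    \<comment> \<open>The exponent \<open>b - s\<close> from the weight and \<open>s\<close> from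
      the interval length add up to \<open>b\<close>, the exponent in the covering bound.\<close>
    also have "real (card (I k)) * (w k * (2 * r k))
      = 2 * unit_ball_vol (b - s) / 2 powr (b - s) * (real (card (I k)) * d k powr b) * L"
      using d(1)[of k] by (simp add: w_def r_def powr_divide powr_diff)
    also have "\<dots> \<le> 2 * unit_ball_vol (b - s) / 2 powr (b - s) * K * L"
      using I(2)[of k] assms(2,3) by (intro mult_right_mono mult_left_mono) auto
    finally show ?thesis by (simp add: ennreal_leI)
  qed
  \<comment> \<open>Monotonicity of the integral requires no measurability of the Hausdorff measure
    in \<open>y\<close>; Fatou's lemma does, and is applied only to \<open>g\<close>.\<close>
  have "(\<integral>\<^sup>+ y. hausdorff_measure (b - s) {x \<in> Q. f x = y} \<partial>lborel)
    \<le> (\<integral>\<^sup>+ y. liminf (\<lambda>k. g k y) \<partial>lborel)"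
    using premeasure_le
    by (intro nn_integral_mono order_trans[OF hausdorff_measure_le_liminf[OF d(2)]] Liminf_mono) auto
  also have "\<dots> \<le> liminf (\<lambda>k. \<integral>\<^sup>+ y. g k y \<partial>lborel)"
    by (intro nn_integral_liminf) (auto simp: g_def)
  also have "\<dots> \<le> ennreal (2 * unit_ball_vol (b - s) / 2 powr (b - s) * K * L)"
    using integral_g by (intro Liminf_le) auto
  also have "\<dots> = ennreal (2 * unit_ball_vol (b - s) / 2 powr (b - s) * K) * holder_seminorm s Q f"
    unfolding L using assms(2,3,4) by (intro ennreal_mult) auto
  finally show ?thesis .
qed

text \<open>The closed cubes share faces, which is harmless: only covering, cardinality and diameter
  enter the estimate.\<close>

definition grid_cube :: "nat \<Rightarrow> ('n \<Rightarrow> nat) \<Rightarrow> (real ^ 'n) set" where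
  "grid_cube N m = {x. \<forall>i. real (m i) / real N \<le> x $ i \<and> x $ i \<le> (real (m i) + 1) / real N}"

lemma unit_cube_subset_grid:
  assumes "0 < N"
  shows "unit_cube \<subseteq> (\<Union>m \<in> UNIV \<rightarrow>\<^sub>E {..<N}. grid_cube N m)"
proof
  fix x :: "real ^ 'n" assume "x \<in> unit_cube"
  then have x: "0 < x $ i" "x $ i < 1" for i by (auto simp: unit_cube_def)
  \<comment> \<open>Since \<open>x $ i\<close> is positive, \<open>nat\<close> does not alter the
    floor; since \<open>x $ i < 1\<close>, the index stays below \<open>N\<close>.\<close>
  define m where "m i = nat \<lfloor>real N * x $ i\<rfloor>" for i
  have m: "real (m i) = of_int \<lfloor>real N * x $ i\<rfloor>" for i
    using x(1)[of i] by (simp add: m_def)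
  have "real (m i) \<le> real N * x $ i" "real N * x $ i \<le> real (m i) + 1" for i
    unfolding m by linarith+
  then have "x \<in> grid_cube N m"
    using assms by (auto simp: grid_cube_def field_simps)
  moreover have "m i < N" for i
  proof -
    have "real (m i) \<le> real N * x $ i" unfolding m by linarith
    also have "\<dots> < real N" using x(2)[of i] assms by simp
    finally show ?thesis by simp
  qed
  ultimately show "x \<in> (\<Union>m \<in> UNIV \<rightarrow>\<^sub>E {..<N}. grid_cube N m)" by (auto simp: PiE_def)
qed

lemma dist_grid_cube_le:
  fixes x y :: "real ^ 'n"
  assumes "x \<in> grid_cube N m" "y \<in> grid_cube N m"
  shows "dist x y \<le> sqrt (real CARD('n)) / real N"
proof -
  have "dist (x $ i) (y $ i) \<le> 1 / real N" for i
    using assms by (auto simp: grid_cube_def dist_real_def abs_le_iff add_divide_distrib)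
      (smt (verit))+
  then have "dist x y \<le> L2_set (\<lambda>i::'n. 1 / real N) UNIV"
    unfolding dist_vec_def by (intro L2_set_mono) auto
  also have "\<dots> = sqrt (real CARD('n)) / real N"
    by (simp add: L2_set_constant)
  finally show ?thesis .
qed

theorem theorem1p1:
  fixes s :: real
  assumes "0 \<le> s" and "s \<le> 1"
  shows "\<exists>C::real. 0 \<le> C \<and>
    (\<forall>f :: real ^ 'n \<Rightarrow> real. f \<in> holder_space s unit_cube \<longrightarrow>
      (\<integral>\<^sup>+ y. hausdorff_measure (real CARD('n) - s) {x \<in> unit_cube. f x = y} \<partial>lborel)
        \<le> ennreal C * holder_seminorm s unit_cube f)"
proof -
  define n where "n = real CARD('n)"
  \<comment> \<open>The diagonal of a cube of side 1/N with N = \<open>Suc k\<close>, which avoids N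
    = 0.\<close>
  define d where "d k = sqrt n / real (Suc k)" for k
  \<comment> \<open>The N^n cubes times (sqrt n / N)^n: the powers of N cancel.\<close>
  define K where "K = sqrt n powr n"
  \<comment> \<open>With \<open>s \<le> 1\<close> this gives \<open>s \<le> n\<close>, so the
    dimension \<open>n - s\<close> is nonnegative.\<close>
  have n: "1 \<le> n" by (simp add: n_def Suc_leI)
  have d0: "0 < d k" for k using n by (simp add: d_def)
  have "d \<longlonglongrightarrow> 0"
    unfolding d_def by (rule LIMSEQ_Suc[OF lim_const_over_n])
  have card: "real (card ((UNIV :: 'n set) \<rightarrow>\<^sub>E {..<Suc k})) * d k powr n \<le> K" for k
  proof -
    have "real (card ((UNIV :: 'n set) \<rightarrow>\<^sub>E {..<Suc k})) = real (Suc k) powr n"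
      using powr_realpow[of "real (Suc k)" "CARD('n)"] by (simp add: card_PiE n_def)
    then show ?thesis using n by (simp add: d_def K_def powr_divide del: of_nat_Suc)
  qed
  show ?thesis
  proof (intro exI[of _ "2 * unit_ball_vol (n - s) / 2 powr (n - s) * K"] conjI allI impI)
    show "0 \<le> 2 * unit_ball_vol (n - s) / 2 powr (n - s) * K"
      using n assms by (simp add: K_def)
    fix f :: "real ^ 'n \<Rightarrow> real" assume "f \<in> holder_space s unit_cube"
    then have "holder_seminorm s unit_cube f < \<infinity>" by (simp add: holder_space_def)
    then obtain L where L: "0 \<le> L" "holder_seminorm s unit_cube f = ennreal L"
      by (cases "holder_seminorm s unit_cube f") auto
    show "(\<integral>\<^sup>+ y. hausdorff_measure (real CARD('n) - s) {x \<in> unit_cube. f x = y} \<partial>lborel)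
      \<le> ennreal (2 * unit_ball_vol (n - s) / 2 powr (n - s) * K) * holder_seminorm s unit_cube f"
      unfolding n_def[symmetric]
    proof (rule nn_integral_hausdorff_measure_level_sets_le[where L = L and d = d
          and I = "\<lambda>k. (UNIV :: 'n set) \<rightarrow>\<^sub>E {..<Suc k}" and P = "\<lambda>k. grid_cube (Suc k)"])
      show "unit_cube \<subseteq> (\<Union>m \<in> UNIV \<rightarrow>\<^sub>E {..<Suc k}. grid_cube (Suc k) m)" for k
        by (rule unit_cube_subset_grid) simp
      show "dist x y \<le> d k" if "x \<in> grid_cube (Suc k) m" "y \<in> grid_cube (Suc k) m"
        for k m and x y :: "real ^ 'n"
        using dist_grid_cube_le[OF that] by (simp add: d_def n_def)
      show "0 \<le> K" by (simp add: K_def)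
    qed (use assms n in \<open>simp_all add: L d0 \<open>d \<longlonglongrightarrow> 0\<close> card finite_PiE del: of_nat_Suc\<close>)
  qed
qed

end
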